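(* Let $N$ be a $k$-commodity network and let $\mathcal{C}$ be the set of all $s$--$t$ cuts of $N$. Then the set of feasible flows through $N$ is precisely the mutual capacity of $\mathcal{C}$: a map is a flow on $N$ if and only if it is a local flow over $\mathcal{C}$, i.e., the gluing of a compatible family of local flows, one over each cut of $\mathcal{C}$.
   Context: A $k$-commodity network $N$ is a directed graph with node set $V$, arc set $E$, source $s$, sink $t$, each arc $a$ having a capacity $C_a\subseteq\mathbb{R}^k$ (an arbitrary region), enhanced by an arc $e$ from $t$ to $s$ with capacity the nonnegative orthant. A flow is a map $\phi:E\cup\{e\}\to\mathbb{R}^k$ such that at every node the sum of $\phi$ over outgoing arcs equals the sum over incoming arcs (counting $e$), and $\phi(a)\in C_a$ for every arc $a$; its flow value is $\phi(e)$. An $s$--$t$ cut is a partition $V=S\sqcup T$ with $s\in S$, $t\in T$; its forward arcs are the arcs from $S$ to $T$, its backward arcs those from $T$ to $S$, and $e$ belongs to every cut. For a set of cuts $\mathcal{C}$, $E(\mathcal{C})$ is the union of their arc sets. A local flow over $\mathcal{C}$ is a map $\phi_L:E(\mathcal{C})\cup\{e\}\to\mathbb{R}^k$ with $\phi_L(a)\in C_a$ for every arc in its domain and $\phi_L(e)=\sum_{a\in F_c}\phi_L(a)-\sum_{a\in B_c}\phi_L(a)$ for each $c\in\mathcal{C}$ ($F_c$, $B_c$ the forward and backward arcs of $c$ in $E$). Local flows are compatible if they agree on every common arc; the gluing of a compatible family is the map on the union of their domains agreeing with each member. The mutual capacity of $\mathcal{C}$ is the set of local flows over $\mathcal{C}$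 (equivalently, indexed by their flow values, the set of flow values $f$ admitting an assignment to the arcs of $E(\mathcal{C})$ respecting capacities with total value $f$ over every cut in $\mathcal{C}$).
   Formalization: The network is assumed finite, without loops and with s different from t; a loop lies in no cut, so with a loop (e.g. of empty capacity) flows and local flows over all cuts differ, and if s = t there are no cuts. *)

theory Defs
  imports
    "HOL-Analysis.Finite_Cartesian_Product"
    "HOL-Library.FuncSet"
    "Graph_Theory.Digraph"
begin

text \<open>
  Parallel and antiparallel arcs are allowed. The return arc from sink to source is not an arc of
  the base digraph; it is adjoined by \<open>enhanced\<close> below as \<open>None\<close>, an original arc \<open>a\<close> becoming
  \<open>Some a\<close>.
\<close>

record ('v, 'a, 'k) network =
  base :: "('v, 'a) pre_digraph"
  source :: 'v
  sink :: 'v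
  capacity :: "'a \<Rightarrow> (real ^ 'k) set"

text \<open>
  Loops are excluded: a loop lies in no cut, so the capacity condition at a loop is invisible to
  local flows. Source and sink are distinct, since otherwise there are no cuts at all.
\<close>

definition is_network :: "('v, 'a, 'k::finite) network \<Rightarrow> bool" where
  "is_network N \<longleftrightarrow>
     fin_digraph (base N) \<and> loopfree_digraph (base N) \<and>
     source N \<in> verts (base N) \<and> sink N \<in> verts (base N) \<and> source N \<noteq> sink N"

definition enhanced :: "('v, 'a, 'k::finite) network \<Rightarrow> ('v, 'a option) pre_digraph" where
  "enhanced N =
     \<lparr> verts = verts (base N),
       arcs = insert None (Some ` arcs (base N)),
       tail = case_option (sink N) (tail (base N)),
       head = case_option (source N) (head (base N)) \<rparr>"

definition enhanced_capacity :: "('v, 'a, 'k::finite) network \<Rightarrow> 'a option \<Rightarrow> (real ^ 'k) set" where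
  "enhanced_capacity N = case_option {x. \<forall>i. 0 \<le> x $ i} (capacity N)"

text \<open>
  Maps defined on a set \<open>D\<close> of arcs are represented by functions that are \<open>undefined\<close> outside
  \<open>D\<close>, so that equality of such functions is equality of domain-restricted maps.
\<close>

definition is_flow ::
  "('v, 'a, 'k::finite) network \<Rightarrow> ('a option \<Rightarrow> real ^ 'k) \<Rightarrow> bool" where
  "is_flow N \<phi> \<longleftrightarrow>
     \<phi> \<in> (\<Pi>\<^sub>E a \<in> arcs (enhanced N). enhanced_capacity N a) \<and>
     (\<forall>v \<in> verts (enhanced N).
        (\<Sum>a \<in> out_arcs (enhanced N) v. \<phi> a) = (\<Sum>a \<in> in_arcs (enhanced N) v. \<phi> a))"

definition flow_value :: "('a option \<Rightarrow> real ^ 'k) \<Rightarrow> real ^ 'k" where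
  "flow_value \<phi> = \<phi> None"

definition cuts :: "('v, 'a, 'k::finite) network \<Rightarrow> ('v set \<times> 'v set) set" where
  "cuts N = {(S, T). S \<union> T = verts (base N) \<and> S \<inter> T = {} \<and> source N \<in> S \<and> sink N \<in> T}"

definition forward_arcs :: "('v, 'a, 'k::finite) network \<Rightarrow> 'v set \<times> 'v set \<Rightarrow> 'a set" where
  "forward_arcs N c = {a \<in> arcs (base N). tail (base N) a \<in> fst c \<and> head (base N) a \<in> snd c}"

definition backward_arcs :: "('v, 'a, 'k::finite) network \<Rightarrow> 'v set \<times> 'v set \<Rightarrow> 'a set" where
  "backward_arcs N c = {a \<in> arcs (base N). tail (base N) a \<in> snd c \<and> head (base N) a \<in> fst c}"

text \<open>The domain \<open>E(\<C>) \<union> {e}\<close> of a local flow over \<open>\<C>\<close>.\<close>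

definition cut_arcs ::
  "('v, 'a, 'k::finite) network \<Rightarrow> ('v set \<times> 'v set) set \<Rightarrow> 'a option set" where
  "cut_arcs N \<C> = insert None (Some ` (\<Union>c \<in> \<C>. forward_arcs N c \<union> backward_arcs N c))"

definition is_local_flow ::
  "('v, 'a, 'k::finite) network \<Rightarrow> ('v set \<times> 'v set) set \<Rightarrow>
     ('a option \<Rightarrow> real ^ 'k) \<Rightarrow> bool" where
  "is_local_flow N \<C> \<phi> \<longleftrightarrow>
     \<phi> \<in> (\<Pi>\<^sub>E a \<in> cut_arcs N \<C>. enhanced_capacity N a) \<and>
     (\<forall>c \<in> \<C>. \<phi> None =
        (\<Sum>a \<in> forward_arcs N c. \<phi> (Some a)) - (\<Sum>a \<in> backward_arcs N c. \<phi> (Some a)))"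

definition mutual_capacity ::
  "('v, 'a, 'k::finite) network \<Rightarrow> ('v set \<times> 'v set) set \<Rightarrow>
     ('a option \<Rightarrow> real ^ 'k) set" where
  "mutual_capacity N \<C> = {\<phi>. is_local_flow N \<C> \<phi>}"

text \<open>The mutual capacity recorded by flow values; a flow value lies in the capacity of the
  return arc.\<close>

definition mutual_capacity_values ::
  "('v, 'a, 'k::finite) network \<Rightarrow> ('v set \<times> 'v set) set \<Rightarrow> (real ^ 'k) set" where
  "mutual_capacity_values N \<C> =
     {f. (\<forall>i. 0 \<le> f $ i) \<and>
         (\<exists>x. (\<forall>c \<in> \<C>. \<forall>a \<in> forward_arcs N c \<union> backward_arcs N c. x a \<in> capacity N a) \<and>
              (\<forall>c \<in> \<C>. (\<Sum>a \<in> forward_arcs N c. x a) - (\<Sum>a \<in> backward_arcs N c. x a) = f))}"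

text \<open>For a family \<open>\<Phi>\<close> of maps indexed by \<open>I\<close>, the map \<open>\<Phi> i\<close> having domain \<open>D i\<close>.\<close>

definition compatible :: "'i set \<Rightarrow> ('i \<Rightarrow> 'b set) \<Rightarrow> ('i \<Rightarrow> 'b \<Rightarrow> 'c) \<Rightarrow> bool" where
  "compatible I D \<Phi> \<longleftrightarrow> (\<forall>i \<in> I. \<forall>j \<in> I. \<forall>a \<in> D i \<inter> D j. \<Phi> i a = \<Phi> j a)"

definition is_gluing ::
  "'i set \<Rightarrow> ('i \<Rightarrow> 'b set) \<Rightarrow> ('i \<Rightarrow> 'b \<Rightarrow> 'c) \<Rightarrow> ('b \<Rightarrow> 'c) \<Rightarrow> bool" where
  "is_gluing I D \<Phi> \<phi> \<longleftrightarrow>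
     \<phi> \<in> extensional (\<Union>i \<in> I. D i) \<and> (\<forall>i \<in> I. \<forall>a \<in> D i. \<phi> a = \<Phi> i a)"

end

theory Submission
  imports Defs
begin

text \<open>
  The net outflow of a vertex set is additive over its vertices. Conservation at every vertex hence
  gives the right net outflow across every cut. Conversely, comparing the cut around
  \<open>{s}\<close> with the cut around \<open>{s, v}\<close> recovers conservation at an inner vertex \<open>v\<close>, while \<open>{s}\<close> and
  the complement of \<open>{t}\<close> give conservation at the terminals. As there are no loops, every arc
  crosses some cut.
\<close>

section \<open>Net outflow of vertex sets\<close>

definition net_outflow ::
  "('v, 'a) pre_digraph \<Rightarrow> ('a \<Rightarrow> 'b::ab_group_add) \<Rightarrow> 'v \<Rightarrow> 'b" where
  "net_outflow G x v = (\<Sum>a \<in> out_arcs G v. x a) - (\<Sum>a \<in> in_arcs G v. x a)"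

text \<open>An arc with both ends in \<open>S\<close> is counted once at its tail and once at its
  head with opposite signs, so only arcs crossing the boundary of \<open>S\<close> survive.\<close>

lemma (in fin_digraph) sum_net_outflow:
  assumes "S \<subseteq> verts G"
  shows "(\<Sum>v\<in>S. net_outflow G x v) =
    (\<Sum>a | a \<in> arcs G \<and> tail G a \<in> S \<and> head G a \<in> verts G - S. x a) -
    (\<Sum>a | a \<in> arcs G \<and> tail G a \<in> verts G - S \<and> head G a \<in> S. x a)"
proof -
  have fin: "finite S"
    using assms finite_verts by (rule finite_subset)
  \<comment> \<open>Stated for any \<open>g\<close> so that it serves both \<open>tail G\<close> and
    \<open>head G\<close>.\<close>
  have group: "(\<Sum>v\<in>S. \<Sum>a | a \<in> arcs G \<and> g a = v. x a) = (\<Sum>a | a \<in> arcs G \<and> g a \<in> S. x a)"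
    for g :: "'b \<Rightarrow> 'a"
  proof -
    have "(\<Sum>v\<in>S. \<Sum>a | a \<in> arcs G \<and> g a = v. x a) =
        (\<Sum>v\<in>S. sum x {a \<in> {a \<in> arcs G. g a \<in> S}. g a = v})"
      by (intro sum.cong arg_cong[where f = "sum x"]) auto
    also have "\<dots> = (\<Sum>a | a \<in> arcs G \<and> g a \<in> S. x a)"
      using fin by (intro sum.group) auto
    finally show ?thesis .
  qed
  let ?I = "{a \<in> arcs G. tail G a \<in> S \<and> head G a \<in> S}"
  have "{a \<in> arcs G. tail G a \<in> S} =
      ?I \<union> {a \<in> arcs G. tail G a \<in> S \<and> head G a \<in> verts G - S}"
    by auto
  then have tails: "(\<Sum>a | a \<in> arcs G \<and> tail G a \<in> S. x a) =
      sum x ?I + (\<Sum>a | a \<in> arcs G \<and> tail G a \<in> S \<and> head G a \<in> verts G - S. x a)"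
    by (simp only:) (rule sum.union_disjoint; auto)
  have "{a \<in> arcs G. head G a \<in> S} =
      ?I \<union> {a \<in> arcs G. tail G a \<in> verts G - S \<and> head G a \<in> S}"
    by auto
  then have heads: "(\<Sum>a | a \<in> arcs G \<and> head G a \<in> S. x a) =
      sum x ?I + (\<Sum>a | a \<in> arcs G \<and> tail G a \<in> verts G - S \<and> head G a \<in> S. x a)"
    by (simp only:) (rule sum.union_disjoint; auto)
  show ?thesis
    by (simp add: net_outflow_def sum_subtractf out_arcs_def in_arcs_def group tails heads)
qed

section \<open>Cut sums and the arcs lying in cuts\<close>

lemma cuts_iff:
  "c \<in> cuts N \<longleftrightarrow>
    (\<exists>S. c = (S, verts (base N) - S) \<and> S \<subseteq> verts (base N) \<and> source N \<in> S \<and> sink N \<notin> S \<and>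
      sink N \<in> verts (base N))"
  by (cases c) (auto simp: cuts_def)

text \<open>\<open>S\<close> may be any set of vertices, not only the source side of a cut; the case
  of all vertices yields that the total net outflow vanishes.\<close>

lemma cut_sum_eq_net_outflow:
  assumes "is_network N" "S \<subseteq> verts (base N)"
  defines "c \<equiv> (S, verts (base N) - S)"
  shows "(\<Sum>a \<in> forward_arcs N c. x a) - (\<Sum>a \<in> backward_arcs N c. x a) =
    (\<Sum>v\<in>S. net_outflow (base N) x v)"
  using fin_digraph.sum_net_outflow[of "base N" S x] assms
  by (simp add: is_network_def forward_arcs_def backward_arcs_def)

text \<open>The two ends of an arc differ, so one of them can be put on the side of the source and
  the other on the side of the sink.\<close>

lemma arc_in_some_cut:
  assumes N: "is_network N" and a: "a \<in> arcs (base N)"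
  obtains c where "c \<in> cuts N" "a \<in> forward_arcs N c \<union> backward_arcs N c"
proof -
  interpret fin_digraph "base N" using N by (simp add: is_network_def)
  interpret loopfree_digraph "base N" using N by (simp add: is_network_def)
  let ?u = "tail (base N) a" and ?v = "head (base N) a"
  have uv: "?u \<in> verts (base N)" "?v \<in> verts (base N)" "?u \<noteq> ?v"
    using a no_loops by auto
  \<comment> \<open>\<open>w\<close> is the end that joins the source. The choice ensures that
    \<open>w\<close> is not the sink and that the other end is not the source.\<close>
  define w where "w = (if ?u = sink N \<or> ?v = source N then ?v else ?u)"
  let ?S = "{source N, w}"
  show ?thesis
  proof (rule that)
    show "(?S, verts (base N) - ?S) \<in> cuts N"
      using N uv by (auto simp: cuts_def is_network_def w_def)
    show "a \<in> forward_arcs N (?S, verts (base N) - ?S) \<union> backward_arcs N (?S, verts (base N) - ?S)"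
      using N a uv by (auto simp: forward_arcs_def backward_arcs_def is_network_def w_def)
  qed
qed

text \<open>Flows and local flows over all cuts thus have the same domain and the same capacity
  constraints.\<close>

lemma cut_arcs_cuts:
  assumes "is_network N"
  shows "cut_arcs N (cuts N) = arcs (enhanced N)"
proof -
  have "(\<Union>c \<in> cuts N. forward_arcs N c \<union> backward_arcs N c) = arcs (base N)"
  proof
    show "(\<Union>c \<in> cuts N. forward_arcs N c \<union> backward_arcs N c) \<subseteq> arcs (base N)"
      by (auto simp: forward_arcs_def backward_arcs_def)
    show "arcs (base N) \<subseteq> (\<Union>c \<in> cuts N. forward_arcs N c \<union> backward_arcs N c)"
    proof
      fix a assume "a \<in> arcs (base N)"
      then obtain c where "c \<in> cuts N" "a \<in> forward_arcs N c \<union> backward_arcs N c"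
        by (rule arc_in_some_cut[OF assms])
      then show "a \<in> (\<Union>c \<in> cuts N. forward_arcs N c \<union> backward_arcs N c)"
        by (rule UN_I)
    qed
  qed
  then show ?thesis
    by (simp add: cut_arcs_def enhanced_def)
qed

section \<open>Node conservation and cut values\<close>

text \<open>The return arc leaves only the sink and enters only the source. Moving its terms to the
  right-hand side leaves a condition on the base digraph alone.\<close>

lemma enhanced_conservation_iff:
  assumes "is_network N"
  shows "(\<Sum>a \<in> out_arcs (enhanced N) v. \<phi> a) = (\<Sum>a \<in> in_arcs (enhanced N) v. \<phi> a) \<longleftrightarrow>
    net_outflow (base N) (\<lambda>a. \<phi> (Some a)) v =
      (if v = source N then \<phi> None else 0) - (if v = sink N then \<phi> None else 0)"
proof -
  have fin: "finite (arcs (base N))"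
    using assms by (simp add: is_network_def fin_digraph.finite_arcs)
  have "out_arcs (enhanced N) v =
      Some ` out_arcs (base N) v \<union> (if v = sink N then {None} else {})"
    by (auto simp: out_arcs_def enhanced_def)
  moreover have "in_arcs (enhanced N) v =
      Some ` in_arcs (base N) v \<union> (if v = source N then {None} else {})"
    by (auto simp: in_arcs_def enhanced_def)
  moreover have "finite (out_arcs (base N) v)" "finite (in_arcs (base N) v)"
    using fin by (auto simp: out_arcs_def in_arcs_def)
  ultimately show ?thesis
    by (auto simp: net_outflow_def sum.reindex algebra_simps eq_diff_eq diff_eq_eq)
qed

text \<open>A purely linear equivalence for arbitrary \<open>x\<close> and \<open>f\<close>; it is
  applied to the values of a map on the original arcs and on the return arc.\<close>

lemma conservation_iff_cut_values:
  fixes x :: "'a \<Rightarrow> real ^ 'k::finite" and N :: "('v, 'a, 'k) network"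
  assumes N: "is_network N"
  shows "(\<forall>v \<in> verts (base N). net_outflow (base N) x v =
      (if v = source N then f else 0) - (if v = sink N then f else 0)) \<longleftrightarrow>
    (\<forall>c \<in> cuts N. f = (\<Sum>a \<in> forward_arcs N c. x a) - (\<Sum>a \<in> backward_arcs N c. x a))"
    (is "?L \<longleftrightarrow> ?R")
proof
  let ?V = "verts (base N)" and ?s = "source N" and ?t = "sink N"
  let ?n = "net_outflow (base N) x"
  have st: "?s \<in> ?V" "?t \<in> ?V" "?s \<noteq> ?t" and fin: "finite ?V"
    using N by (auto simp: is_network_def fin_digraph.finite_verts)
  {
    assume L: ?L
    show ?R
    proof
      fix c assume "c \<in> cuts N"
      then obtain S where c: "c = (S, ?V - S)" and S: "S \<subseteq> ?V" "?s \<in> S" "?t \<notin> S"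
        by (auto simp: cuts_iff)
      \<comment> \<open>The sink lies outside \<open>S\<close>, so its term drops out.\<close>
      have "(\<Sum>v\<in>S. ?n v) = (\<Sum>v\<in>S. if v = ?s then f else 0)"
        using L S st by (intro sum.cong) auto
      also have "\<dots> = f"
        using S finite_subset[OF S(1) fin] by simp
      finally show "f = (\<Sum>a \<in> forward_arcs N c. x a) - (\<Sum>a \<in> backward_arcs N c. x a)"
        using cut_sum_eq_net_outflow[OF N S(1), of x] c by simp
    qed
  }
  {
    assume R: ?R
    have cut: "(\<Sum>v\<in>S. ?n v) = f" if S: "S \<subseteq> ?V" "?s \<in> S" "?t \<notin> S" for S
    proof -
      have "(S, ?V - S) \<in> cuts N"
        using S st by (auto simp: cuts_iff)
      then show ?thesis
        using R cut_sum_eq_net_outflow[OF N S(1), of x] by simp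
    qed
    have s: "?n ?s = f"
      using cut[of "{?s}"] st by simp
    \<comment> \<open>With all vertices on one side and none on the other, no arc crosses.\<close>
    have "(\<Sum>v\<in>?V. ?n v) = 0"
      using cut_sum_eq_net_outflow[OF N order_refl, of x]
      by (simp add: forward_arcs_def backward_arcs_def)
    then have t: "?n ?t = - f"
      using cut[of "?V - {?t}"] st fin sum.remove[OF fin st(2), of ?n]
      by (simp add: eq_neg_iff_add_eq_0)
    \<comment> \<open>The vertices of \<open>{?s, v}\<close> have total net outflow
      \<open>f\<close>, and \<open>?s\<close> alone already accounts for it.\<close>
    have "?n v = 0" if "v \<in> ?V" "v \<noteq> ?s" "v \<noteq> ?t" for v
      using cut[of "{?s, v}"] that st s by simp
    with s t show ?L
      using st by auto
  }
qed

lemma is_flow_iff_is_local_flow: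
  assumes "is_network N"
  shows "is_flow N \<phi> \<longleftrightarrow> is_local_flow N (cuts N) \<phi>"
proof -
  have "verts (enhanced N) = verts (base N)"
    by (simp add: enhanced_def)
  then show ?thesis
    using conservation_iff_cut_values[OF assms, of "\<lambda>a. \<phi> (Some a)" "\<phi> None"]
    by (simp add: is_flow_def is_local_flow_def cut_arcs_cuts[OF assms]
        enhanced_conservation_iff[OF assms])
qed

section \<open>Gluing local flows over single cuts\<close>

text \<open>For empty \<open>\<C>\<close> the union would be empty, whereas
  \<open>cut_arcs N {}\<close> still contains the return arc.\<close>

lemma UN_cut_arcs_singleton:
  assumes "\<C> \<noteq> {}"
  shows "(\<Union>c\<in>\<C>. cut_arcs N {c}) = cut_arcs N \<C>"
  using assms by (auto simp: cut_arcs_def)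

text \<open>Capacities are checked arc by arc, and the value equation of a cut involves only the
  return arc and the arcs of that cut.\<close>

lemma is_local_flow_iff_restrictions:
  assumes "\<C> \<noteq> {}" and "\<phi> \<in> extensional (cut_arcs N \<C>)"
  shows "is_local_flow N \<C> \<phi> \<longleftrightarrow>
    (\<forall>c\<in>\<C>. is_local_flow N {c} (restrict \<phi> (cut_arcs N {c})))"
proof -
  have val: "restrict \<phi> (cut_arcs N {c}) None = \<phi> None"
      "(\<Sum>a \<in> forward_arcs N c. restrict \<phi> (cut_arcs N {c}) (Some a)) =
        (\<Sum>a \<in> forward_arcs N c. \<phi> (Some a))"
      "(\<Sum>a \<in> backward_arcs N c. restrict \<phi> (cut_arcs N {c}) (Some a)) =
        (\<Sum>a \<in> backward_arcs N c. \<phi> (Some a))" for c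
    by (auto intro: sum.cong simp: cut_arcs_def)
  have "\<phi> \<in> (\<Pi>\<^sub>E a \<in> cut_arcs N \<C>. enhanced_capacity N a) \<longleftrightarrow>
      (\<forall>c\<in>\<C>. \<forall>a\<in>cut_arcs N {c}. \<phi> a \<in> enhanced_capacity N a)"
    using assms(2) unfolding UN_cut_arcs_singleton[OF assms(1), symmetric]
    by (auto simp: PiE_iff)
  then show ?thesis
    by (auto simp: is_local_flow_def val restrict_PiE_iff simp del: restrict_apply)
qed

lemma is_local_flow_iff_gluing:
  assumes "\<C> \<noteq> {}"
  shows "is_local_flow N \<C> \<phi> \<longleftrightarrow>
    (\<exists>\<Phi>. (\<forall>c \<in> \<C>. is_local_flow N {c} (\<Phi> c)) \<and>
          compatible \<C> (\<lambda>c. cut_arcs N {c}) \<Phi> \<and>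
          is_gluing \<C> (\<lambda>c. cut_arcs N {c}) \<Phi> \<phi>)" (is "_ \<longleftrightarrow> ?R")
proof
  assume \<phi>: "is_local_flow N \<C> \<phi>"
  then have ext: "\<phi> \<in> extensional (cut_arcs N \<C>)"
    by (auto simp: is_local_flow_def PiE_def)
  then show ?R
    using \<phi> is_local_flow_iff_restrictions[OF assms ext]
    \<comment> \<open>Restrictions of a single map agree on overlaps, so this family is compatible
      and glues to \<open>\<phi>\<close>.\<close>
    by (intro exI[of _ "\<lambda>c. restrict \<phi> (cut_arcs N {c})"])
      (simp add: compatible_def is_gluing_def UN_cut_arcs_singleton[OF assms])
next
  assume ?R
  then obtain \<Phi> where \<Phi>: "\<And>c. c \<in> \<C> \<Longrightarrow> is_local_flow N {c} (\<Phi> c)"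
    and glue: "is_gluing \<C> (\<lambda>c. cut_arcs N {c}) \<Phi> \<phi>"
    by blast
  have ext: "\<phi> \<in> extensional (cut_arcs N \<C>)"
    using glue by (simp add: is_gluing_def UN_cut_arcs_singleton[OF assms])
  \<comment> \<open>Both maps are \<open>undefined\<close> off \<open>cut_arcs N {c}\<close>, so
    agreement there is equality.\<close>
  have "restrict \<phi> (cut_arcs N {c}) = \<Phi> c" if "c \<in> \<C>" for c
    using glue \<Phi>[OF that] that
    by (intro extensionalityI[of _ "cut_arcs N {c}"])
      (auto simp: is_gluing_def is_local_flow_def PiE_def)
  then show "is_local_flow N \<C> \<phi>"
    using \<Phi> by (simp add: is_local_flow_iff_restrictions[OF assms ext])
qed

section \<open>Mutual capacity in terms of flow values\<close>

lemma flow_value_image_mutual_capacity: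
  "flow_value ` mutual_capacity N \<C> = mutual_capacity_values N \<C>"
proof (intro set_eqI iffI)
  fix f assume "f \<in> flow_value ` mutual_capacity N \<C>"
  then obtain \<phi> where \<phi>: "is_local_flow N \<C> \<phi>" and f: "f = \<phi> None"
    by (auto simp: mutual_capacity_def flow_value_def)
  have cap: "\<phi> a \<in> enhanced_capacity N a" if "a \<in> cut_arcs N \<C>" for a
    using \<phi> that by (auto simp: is_local_flow_def)
  have "\<forall>i. 0 \<le> f $ i"
    using cap[of None] by (simp add: f cut_arcs_def enhanced_capacity_def)
  moreover have "\<phi> (Some a) \<in> capacity N a"
    if "c \<in> \<C>" "a \<in> forward_arcs N c \<union> backward_arcs N c" for a c
    using cap[of "Some a"] that by (auto simp: cut_arcs_def enhanced_capacity_def)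
  ultimately show "f \<in> mutual_capacity_values N \<C>"
    using \<phi> unfolding mutual_capacity_values_def is_local_flow_def f
    by (intro CollectI conjI exI[of _ "\<lambda>a. \<phi> (Some a)"]) auto
next
  fix f assume "f \<in> mutual_capacity_values N \<C>"
  then obtain x where nonneg: "\<forall>i. 0 \<le> f $ i"
    and cap: "\<And>c a. c \<in> \<C> \<Longrightarrow> a \<in> forward_arcs N c \<union> backward_arcs N c \<Longrightarrow> x a \<in> capacity N a"
    and val: "\<And>c. c \<in> \<C> \<Longrightarrow> (\<Sum>a \<in> forward_arcs N c. x a) - (\<Sum>a \<in> backward_arcs N c. x a) = f"
    unfolding mutual_capacity_values_def by blast
  \<comment> \<open>The return arc carries \<open>f\<close> and the original arcs carry
    \<open>x\<close>; restricting makes the map extensional, as a local flow must be.\<close>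
  define \<phi> where "\<phi> = restrict (case_option f x) (cut_arcs N \<C>)"
  have None: "\<phi> None = f"
    by (simp add: \<phi>_def cut_arcs_def)
  have Some: "\<phi> (Some a) = x a" if "c \<in> \<C>" "a \<in> forward_arcs N c \<union> backward_arcs N c" for a c
    using that by (auto simp: \<phi>_def cut_arcs_def)
  have "\<phi> \<in> (\<Pi>\<^sub>E a \<in> cut_arcs N \<C>. enhanced_capacity N a)"
    unfolding \<phi>_def using nonneg cap
    by (auto simp: cut_arcs_def enhanced_capacity_def)
  moreover have "(\<Sum>a \<in> forward_arcs N c. \<phi> (Some a)) - (\<Sum>a \<in> backward_arcs N c. \<phi> (Some a)) = f"
    if "c \<in> \<C>" for c
    using Some[OF that] val[OF that] by simp
  ultimately have "is_local_flow N \<C> \<phi>"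
    by (simp add: is_local_flow_def None)
  then show "f \<in> flow_value ` mutual_capacity N \<C>"
    by (intro image_eqI[of _ _ \<phi>]) (simp_all add: mutual_capacity_def flow_value_def None)
qed

theorem theorem8:
  fixes N :: "('v, 'a, 'k::finite) network"
  assumes "is_network N"
  shows "{\<phi>. is_flow N \<phi>} = mutual_capacity N (cuts N)
    \<and> (\<forall>\<phi>. is_flow N \<phi> \<longleftrightarrow> is_local_flow N (cuts N) \<phi>)
    \<and> (\<forall>\<phi>. is_local_flow N (cuts N) \<phi> \<longleftrightarrow>
          (\<exists>\<Phi>. (\<forall>c \<in> cuts N. is_local_flow N {c} (\<Phi> c)) \<and>
                compatible (cuts N) (\<lambda>c. cut_arcs N {c}) \<Phi> \<and>
                is_gluing (cuts N) (\<lambda>c. cut_arcs N {c}) \<Phi> \<phi>))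
    \<and> flow_value ` {\<phi>. is_flow N \<phi>} = mutual_capacity_values N (cuts N)"
proof -
  \<comment> \<open>A cut exists because source and sink differ; the gluing equivalence requires a
    nonempty set of cuts.\<close>
  have "({source N}, verts (base N) - {source N}) \<in> cuts N"
    using assms by (auto simp: cuts_def is_network_def)
  then have "cuts N \<noteq> {}"
    by blast
  moreover have "{\<phi>. is_flow N \<phi>} = mutual_capacity N (cuts N)"
    by (simp add: mutual_capacity_def is_flow_iff_is_local_flow[OF assms])
  ultimately show ?thesis
    using is_flow_iff_is_local_flow[OF assms] is_local_flow_iff_gluing
      flow_value_image_mutual_capacity by metis
qed

end
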